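(* Let $\tau\in\mathbf C$ with $\operatorname{Im}\tau>0$ and, with $q=e^{\pi i\tau}$, let $$C(x,y|\tau)=e^{2ix}e^{2iy}\sum_{k,\ell\in\mathbf Z}q^{2(\ell^2+\ell k+k^2+k+\ell+1/3)}e^{2ix(2\ell+k)}e^{2iy(2k+\ell)}.$$ Then for all $x,y\in\mathbf C$, $$C^3(x,y|\tau)-C^3(-x,-y|\tau)=C^3(x+\pi/3,y|\tau)-C^3(-x-\pi/3,-y|\tau).$$
   Context: Real powers of $q$ are defined by $q^r=e^{\pi i r\tau}$. $C^3(x,y|\tau)$ denotes $(C(x,y|\tau))^3$. *)

theory Defs
  imports "HOL-Analysis.Analysis"
begin

(* q^r for q = exp (pi i tau), with the branch fixed by tau.  This is not q powr r, which
   uses the principal logarithm of q and so depends on tau only modulo 2. *)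
definition qpow :: "complex \<Rightarrow> real \<Rightarrow> complex" where
  "qpow \<tau> r = exp (complex_of_real pi * \<i> * complex_of_real r * \<tau>)"

(* For Im tau > 0 the double series converges absolutely, since l^2 + l k + k^2 is positive
   definite; otherwise infsum may return its default value 0. *)
definition cubic_theta_C :: "complex \<Rightarrow> complex \<Rightarrow> complex \<Rightarrow> complex" where
  "cubic_theta_C x y \<tau> =
     exp (2 * \<i> * x) * exp (2 * \<i> * y) *
     (\<Sum>\<^sub>\<infinity>(k, l)\<in>(UNIV :: (int \<times> int) set).
        qpow \<tau> (2 * (real_of_int (l\<^sup>2 + l * k + k\<^sup>2 + k + l) + 1 / 3)) *
        exp (2 * \<i> * x * of_int (2 * l + k)) *
        exp (2 * \<i> * y * of_int (2 * k + l)))"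

end

(* Expanding the cube gives a sum over triples (v1, v2, v3) from the coset A + (1/3, 1/3) of the
   hexagonal lattice A, weighted by q^(2 (Q v1 + Q v2 + Q v3)); x and y enter only through
   s = v1 + v2 + v3. Write s = (a, b). If a = b mod 3, the shift of x by pi/3 multiplies the term
   by a cube root of unity that is 1. Otherwise, rotating each v_i about the centroid s/3 by
   2 pi/3, in a direction depending on a - b mod 3, keeps s and Q v1 + Q v2 + Q v3 and moves the
   triple to the coset A - (1/3, 1/3), over which C(-x, -y) is summed. These terms therefore
   cancel in C^3(x, y) - C^3(-x, -y), and what is left is invariant under the shift. *)

theory Submission
  imports Defs
begin

no_notation Infinite_Set_Sum.abs_summable_on (infix "abs'_summable'_on" 50)

section \<open>Products of absolutely convergent sums and an integrable majorant on the
  integers\<close>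

lemma abs_summable_on_times:
  fixes f :: "'a \<Rightarrow> complex" and g :: "'b \<Rightarrow> complex"
  assumes f: "f abs_summable_on A" and g: "g abs_summable_on B"
  shows "(\<lambda>(a, b). f a * g b) abs_summable_on (A \<times> B)"
proof -
  have "(\<lambda>b. f a * g b) abs_summable_on B" for a
    using summable_on_cmult_right[OF g, of "norm (f a)"] by (simp add: norm_mult)
  moreover have "(\<lambda>a. \<Sum>\<^sub>\<infinity>b\<in>B. norm (f a * g b)) abs_summable_on A"
    using summable_on_cmult_left[OF f, of "\<Sum>\<^sub>\<infinity>b\<in>B. norm (g b)"]
    by (simp add: norm_mult infsum_cmult_right' infsum_nonneg)
  ultimately show ?thesis
    by (subst Infinite_Sum.abs_summable_on_Sigma_iff) auto
qed

lemma infsum_times: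
  fixes f :: "'a \<Rightarrow> complex" and g :: "'b \<Rightarrow> complex"
  assumes f: "f abs_summable_on A" and g: "g abs_summable_on B"
  shows "infsum (\<lambda>(a, b). f a * g b) (A \<times> B) = infsum f A * infsum g B"
proof -
  have "(\<lambda>(a, b). f a * g b) summable_on (A \<times> B)"
    using abs_summable_on_times[OF f g] by (rule abs_summable_summable)
  from infsum_Sigma'_banach[OF this] show ?thesis
    by (simp add: infsum_cmult_right' infsum_cmult_left')
qed

lemma summable_on_exp_neg_abs_int: "(\<lambda>n::int. exp (- \<bar>real_of_int n\<bar>)) summable_on UNIV"
proof -
  let ?f = "\<lambda>n::int. exp (- \<bar>real_of_int n\<bar>)"
  have exp_nat: "(\<lambda>n::nat. exp (- real n)) summable_on UNIV"
  proof (rule norm_summable_imp_summable_on)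
    have "summable (\<lambda>n. exp (- 1 :: real) ^ n)"
      by (rule summable_geometric) simp
    then show "summable (\<lambda>n. norm (exp (- real n)))"
      by (simp flip: exp_of_nat_mult)
  qed
  have "?f summable_on range int"
    by (subst summable_on_reindex) (use exp_nat in \<open>auto simp: o_def inj_on_def\<close>)
  moreover have "?f summable_on range (\<lambda>n. - int n)"
    by (subst summable_on_reindex) (use exp_nat in \<open>auto simp: o_def inj_on_def\<close>)
  ultimately have "?f summable_on (range int \<union> range (\<lambda>n. - int n))"
    by (rule summable_on_union)
  also have "range int \<union> range (\<lambda>n. - int n) = UNIV"
  proof -
    have "n \<in> range int \<union> range (\<lambda>n. - int n)" for n
      by (cases n rule: int_cases2) auto
    then show ?thesis by blast
  qed
  finally show ?thesis .
qed

text \<open>The prefactor of the theta function is absorbed here: the term belongs to the point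
  \<open>(l + 1/3, k + 1/3)\<close> of the dual lattice.\<close>

definition theta_term :: "complex \<Rightarrow> complex \<Rightarrow> complex \<Rightarrow> int \<times> int \<Rightarrow> complex" where
  "theta_term \<tau> x y = (\<lambda>(k, l).
     exp (2 * of_real pi * \<i> * \<tau> * (of_int (l\<^sup>2 + l * k + k\<^sup>2 + k + l) + 1 / 3)
        + 2 * \<i> * x * of_int (2 * l + k + 1) + 2 * \<i> * y * of_int (2 * k + l + 1)))"

lemma cubic_theta_C_eq_infsum: "cubic_theta_C x y \<tau> = infsum (theta_term \<tau> x y) UNIV"
proof -
  have *: "exp (2 * \<i> * x) * exp (2 * \<i> * y) *
        (qpow \<tau> (2 * (real_of_int (l\<^sup>2 + l * k + k\<^sup>2 + k + l) + 1 / 3)) *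
        exp (2 * \<i> * x * of_int (2 * l + k)) *
        exp (2 * \<i> * y * of_int (2 * k + l))) = theta_term \<tau> x y (k, l)" for k l
    unfolding theta_term_def qpow_def prod.case exp_add[symmetric]
    by (rule arg_cong[where f = exp]) (simp add: algebra_simps)
  show ?thesis
    unfolding cubic_theta_C_def infsum_cmult_right'[symmetric]
    by (rule infsum_cong) (use * in auto)
qed

text \<open>Completing the square. The margin \<bar>t\<bar> on the right becomes the summable factor
  exp (- \<bar>t\<bar>).\<close>

lemma linear_le_quadratic:
  fixes b c :: real
  assumes "c > 0"
  obtains M where "\<And>t. b * t - c * t\<^sup>2 \<le> M - \<bar>t\<bar>"
proof
  fix t :: real
  let ?B = "\<bar>b\<bar> + 1"
  have "0 \<le> (2 * c * \<bar>t\<bar> - ?B)\<^sup>2" by simp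
  then have "?B * \<bar>t\<bar> - c * \<bar>t\<bar>\<^sup>2 \<le> ?B\<^sup>2 / (4 * c)"
    using assms by (simp add: field_simps power2_eq_square del: abs_mult_self_eq)
  moreover have "b * t \<le> \<bar>b\<bar> * \<bar>t\<bar>"
    by (metis abs_ge_self abs_mult)
  ultimately show "b * t - c * t\<^sup>2 \<le> ?B\<^sup>2 / (4 * c) - \<bar>t\<bar>"
    by (simp add: algebra_simps)
qed

lemma theta_term_abs_summable:
  assumes "Im \<tau> > 0"
  shows "theta_term \<tau> x y abs_summable_on UNIV"
proof -
  define c where "c = pi * Im \<tau>"
  have c: "c > 0" using assms by (simp add: c_def)
  \<comment> \<open>\<open>b1\<close> and \<open>b2\<close> are the coefficients of l and k in the
    real part of the exponent of \<open>theta_term\<close>.\<close>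
  define b1 where "b1 = - 2 * c - 4 * Im x - 2 * Im y"
  define b2 where "b2 = - 2 * c - 2 * Im x - 4 * Im y"
  obtain M1 where M1: "\<And>t. b1 * t - c * t\<^sup>2 \<le> M1 - \<bar>t\<bar>" using linear_le_quadratic[OF c] by blast
  obtain M2 where M2: "\<And>t. b2 * t - c * t\<^sup>2 \<le> M2 - \<bar>t\<bar>" using linear_le_quadratic[OF c] by blast
  define K where "K = exp (M1 + M2 - 2 * c / 3 - 2 * Im x - 2 * Im y)"
  let ?e = "\<lambda>n::int. complex_of_real (exp (- \<bar>real_of_int n\<bar>))"
  have "?e abs_summable_on UNIV"
    using summable_on_exp_neg_abs_int by simp
  from abs_summable_on_times[OF this this]
  have "(\<lambda>p. norm (case p of (k, l) \<Rightarrow> ?e k * ?e l)) summable_on UNIV" by simp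
  from summable_on_cmult_right[OF this, of K] show ?thesis
  proof (rule Infinite_Sum.abs_summable_on_comparison_test')
    fix p :: "int \<times> int"
    obtain k l where p: "p = (k, l)" by fastforce
    let ?k = "real_of_int k" and ?l = "real_of_int l"
    have "norm (theta_term \<tau> x y p) =
        exp (- 2 * c * (?l\<^sup>2 + ?l * ?k + ?k\<^sup>2 + ?k + ?l + 1 / 3)
          - 2 * Im x * (2 * ?l + ?k + 1) - 2 * Im y * (2 * ?k + ?l + 1))"
      unfolding p theta_term_def prod.case norm_exp_eq_Re c_def
      by (rule arg_cong[where f = exp]) (simp add: power2_eq_square algebra_simps)
    also have "\<dots> \<le> exp (M1 + M2 - 2 * c / 3 - 2 * Im x - 2 * Im y - \<bar>?k\<bar> - \<bar>?l\<bar>)"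
    proof -
      \<comment> \<open>Twice the form l^2 + l k + k^2 is l^2 + k^2 + (l + k)^2; dropping the last
        square separates l from k.\<close>
      have "0 \<le> c * (?l + ?k)\<^sup>2" using c by simp
      then show ?thesis
        using M1[of ?l] M2[of ?k]
        by (simp add: b1_def b2_def power2_eq_square algebra_simps)
    qed
    also have "\<dots> = K * norm (case p of (k, l) \<Rightarrow> ?e k * ?e l)"
      by (simp add: K_def p norm_mult flip: exp_add)
    finally show "norm (theta_term \<tau> x y p) \<le> K * norm (case p of (k, l) \<Rightarrow> ?e k * ?e l)" .
  qed
qed

section \<open>The cube as a sum over triples of lattice points\<close>

type_synonym triple = "(int \<times> int) \<times> (int \<times> int) \<times> (int \<times> int)"

definition theta_term3 :: "complex \<Rightarrow> complex \<Rightarrow> complex \<Rightarrow> triple \<Rightarrow> complex" where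
  "theta_term3 \<tau> x y = (\<lambda>(p, q, r). theta_term \<tau> x y p * (theta_term \<tau> x y q * theta_term \<tau> x y r))"

lemma
  assumes "Im \<tau> > 0"
  shows theta_term3_summable: "theta_term3 \<tau> x y summable_on S"
    and infsum_theta_term3: "infsum (theta_term3 \<tau> x y) UNIV = cubic_theta_C x y \<tau> ^ 3"
proof -
  let ?t = "theta_term \<tau> x y"
  let ?u = "\<lambda>(q, r). ?t q * ?t r"
  note t = theta_term_abs_summable[OF assms, of x y]
  have u: "?u abs_summable_on UNIV"
    using abs_summable_on_times[OF t t] by simp
  have eq: "theta_term3 \<tau> x y = (\<lambda>(p, v). ?t p * ?u v)"
    by (auto simp: theta_term3_def fun_eq_iff)
  have "theta_term3 \<tau> x y summable_on UNIV"
    using abs_summable_on_times[OF t u, THEN abs_summable_summable] by (simp add: eq)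
  then show "theta_term3 \<tau> x y summable_on S"
    by (rule summable_on_subset_banach) simp
  show "infsum (theta_term3 \<tau> x y) UNIV = cubic_theta_C x y \<tau> ^ 3"
    using infsum_times[OF t u] infsum_times[OF t t]
    by (simp add: eq cubic_theta_C_eq_infsum power3_eq_cube)
qed

text \<open>This is Q v1 + Q v2 + Q v3 for Q (a, b) = a^2 + a b + b^2; the final 1 is three times Q
  (1/3, 1/3) = 1/3.\<close>

fun norm3 :: "triple \<Rightarrow> int" where
  "norm3 ((k1, l1), (k2, l2), (k3, l3)) =
     l1\<^sup>2 + l1 * k1 + k1\<^sup>2 + k1 + l1 + (l2\<^sup>2 + l2 * k2 + k2\<^sup>2 + k2 + l2)
     + (l3\<^sup>2 + l3 * k3 + k3\<^sup>2 + k3 + l3) + 1"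

text \<open>With \<open>ksum\<close>, the coordinates of v1 + v2 + v3; the 1 collects the three
  offsets 1/3.\<close>

fun lsum :: "triple \<Rightarrow> int" where
  "lsum ((k1, l1), (k2, l2), (k3, l3)) = l1 + l2 + l3 + 1"

fun ksum :: "triple \<Rightarrow> int" where
  "ksum ((k1, l1), (k2, l2), (k3, l3)) = k1 + k2 + k3 + 1"

lemma theta_term3_eq:
  "theta_term3 \<tau> x y t = exp (2 * of_real pi * \<i> * \<tau> * of_int (norm3 t)
     + 2 * \<i> * x * of_int (2 * lsum t + ksum t) + 2 * \<i> * y * of_int (2 * ksum t + lsum t))"
proof -
  obtain k1 l1 k2 l2 k3 l3 where t: "t = ((k1, l1), (k2, l2), (k3, l3))"
    by (metis surj_pair)
  show ?thesis
    unfolding t theta_term3_def theta_term_def prod.case exp_add[symmetric]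
    by (rule arg_cong[where f = exp]) (simp add: algebra_simps)
qed

definition class3 :: "int \<Rightarrow> triple set" where
  "class3 j = {t. (lsum t - ksum t) mod 3 = j}"

text \<open>On the points \<open>v = (l + 1/3, k + 1/3)\<close> of a triple with sum \<open>s\<close>, both maps are
  \<open>v \<mapsto> - (\<rho> (v - s / 3) + s / 3)\<close>: for \<open>twist\<close>, \<open>\<rho>\<close> is the rotation \<open>(a, b) \<mapsto> (b, - a - b)\<close> of order 3
  of the hexagonal lattice, for \<open>untwist\<close> it is the inverse rotation. The class of \<open>s\<close> decides
  which of the two rotations gives integral \<open>k\<close> and \<open>l\<close>.\<close>

fun twist1 :: "int \<Rightarrow> int \<Rightarrow> int \<times> int \<Rightarrow> int \<times> int" where
  "twist1 m b (k, l) = (k + l - m - b, - (k + m + 1))"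

definition twist :: "triple \<Rightarrow> triple" where
  "twist t = (let m = (lsum t - ksum t) div 3 in
     map_prod (twist1 m (ksum t)) (map_prod (twist1 m (ksum t)) (twist1 m (ksum t))) t)"

fun untwist1 :: "int \<Rightarrow> int \<Rightarrow> int \<times> int \<Rightarrow> int \<times> int" where
  "untwist1 m a (k, l) = (- (l + m + 1), k + l - m - a)"

definition untwist :: "triple \<Rightarrow> triple" where
  "untwist t = (let m = (ksum t - lsum t) div 3 in
     map_prod (untwist1 m (lsum t)) (map_prod (untwist1 m (lsum t)) (untwist1 m (lsum t))) t)"

text \<open>The sum of the Q v_i is the sum of the Q (v_i - s / 3) plus Q s / 3. The rotation and
  the sign change preserve Q, and the rotated differences still sum to 0, so s goes to - s.\<close>

lemma twist:
  assumes "t \<in> class3 1"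
  shows "norm3 (twist t) = norm3 t" "lsum (twist t) = - lsum t" "ksum (twist t) = - ksum t"
    "twist t \<in> class3 2" "untwist (twist t) = t"
proof -
  obtain k1 l1 k2 l2 k3 l3 where t: "t = ((k1, l1), (k2, l2), (k3, l3))"
    by (metis surj_pair)
  define m where "m = (lsum t - ksum t) div 3"
  have "lsum t - ksum t = 3 * m + 1"
    using assms unfolding m_def class3_def by simp presburger
  \<comment> \<open>Eliminating \<open>l1\<close> turns the claims into polynomial identities in
    free integers.\<close>
  then have l1: "l1 = 3 * m + 1 + k1 + k2 + k3 - l2 - l3"
    by (simp add: t)
  have tw: "twist t = ((k1 + l1 - m - ksum t, - (k1 + m + 1)),
    (k2 + l2 - m - ksum t, - (k2 + m + 1)), (k3 + l3 - m - ksum t, - (k3 + m + 1)))"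
    unfolding twist_def Let_def m_def[symmetric] by (simp add: t)
  show "norm3 (twist t) = norm3 t"
    unfolding tw by (simp add: t l1 algebra_simps power2_eq_square)
  show a: "lsum (twist t) = - lsum t"
    unfolding tw by (simp add: t l1)
  show b: "ksum (twist t) = - ksum t"
    unfolding tw by (simp add: t l1)
  show "twist t \<in> class3 2"
    using assms unfolding class3_def mem_Collect_eq a b by presburger
  \<comment> \<open>As s changes sign, \<open>untwist\<close> recovers the same m that
    \<open>twist\<close> used.\<close>
  have m': "(ksum (twist t) - lsum (twist t)) div 3 = m"
    unfolding a b m_def by simp
  show "untwist (twist t) = t"
    unfolding untwist_def Let_def m' unfolding a unfolding tw by (simp add: t l1)
qed

text \<open>\<open>untwist\<close> is \<open>twist\<close> with the two coordinates exchanged, and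
  this exchange swaps the classes 1 and 2.\<close>

lemma untwist:
  assumes "t \<in> class3 2"
  shows "untwist t \<in> class3 1" "twist (untwist t) = t"
proof -
  obtain k1 l1 k2 l2 k3 l3 where t: "t = ((k1, l1), (k2, l2), (k3, l3))"
    by (metis surj_pair)
  define m where "m = (ksum t - lsum t) div 3"
  have "ksum t - lsum t = 3 * m + 1"
    using assms unfolding m_def class3_def by simp presburger
  then have k1: "k1 = 3 * m + 1 + l1 + l2 + l3 - k2 - k3"
    by (simp add: t)
  have tw: "untwist t = ((- (l1 + m + 1), k1 + l1 - m - lsum t),
    (- (l2 + m + 1), k2 + l2 - m - lsum t), (- (l3 + m + 1), k3 + l3 - m - lsum t))"
    unfolding untwist_def Let_def m_def[symmetric] by (simp add: t)
  have a: "lsum (untwist t) = - lsum t"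
    unfolding tw by (simp add: t k1)
  have b: "ksum (untwist t) = - ksum t"
    unfolding tw by (simp add: t k1)
  show "untwist t \<in> class3 1"
    using assms unfolding class3_def mem_Collect_eq a b by presburger
  have m': "(lsum (untwist t) - ksum (untwist t)) div 3 = m"
    unfolding a b m_def by simp
  show "twist (untwist t) = t"
    unfolding twist_def Let_def m' unfolding b unfolding tw by (simp add: t k1)
qed

section \<open>Splitting the cube by residue class\<close>

definition part :: "int \<Rightarrow> complex \<Rightarrow> complex \<Rightarrow> complex \<Rightarrow> complex" where
  "part j \<tau> x y = infsum (theta_term3 \<tau> x y) (class3 j)"

lemma cubic_theta_C_cube:
  assumes "Im \<tau> > 0"
  shows "cubic_theta_C x y \<tau> ^ 3 = part 0 \<tau> x y + part 1 \<tau> x y + part 2 \<tau> x y"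
proof -
  note s = theta_term3_summable[OF assms]
  have U: "UNIV = class3 0 \<union> class3 1 \<union> class3 2"
    unfolding class3_def by auto
  show ?thesis
    unfolding infsum_theta_term3[OF assms, symmetric] part_def U
    by (subst infsum_Un_disjoint[OF s s], force simp: class3_def)+ simp
qed

text \<open>Reindexing by \<open>twist\<close> negates s, which the signs of x and y
  compensate.\<close>

lemma part_1_eq_part_2: "part 1 \<tau> x y = part 2 \<tau> (- x) (- y)"
  unfolding part_def
proof (rule infsum_reindex_bij_witness[where i = untwist and j = twist])
  fix t assume "t \<in> class3 1"
  note tw = twist[OF this]
  show "theta_term3 \<tau> (- x) (- y) (twist t) = theta_term3 \<tau> x y t"
    unfolding theta_term3_eq tw by (rule arg_cong[where f = exp]) (simp add: algebra_simps)
qed (simp_all add: twist untwist)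

text \<open>The shift multiplies a term by exp (2 pi i (2 a + b) / 3), and 2 a + b is congruent to b
  - a mod 3.\<close>

lemma part_0_shift: "part 0 \<tau> (x + complex_of_real pi / 3) y = part 0 \<tau> x y"
  unfolding part_def
proof (rule infsum_cong)
  fix t assume "t \<in> class3 0"
  then have "3 dvd 2 * lsum t + ksum t"
    unfolding class3_def by simp presburger
  then obtain n where n: "2 * lsum t + ksum t = 3 * n" ..
  have "theta_term3 \<tau> (x + complex_of_real pi / 3) y t
      = theta_term3 \<tau> x y t * exp (2 * of_int n * complex_of_real pi * \<i>)"
    unfolding theta_term3_eq n exp_add[symmetric]
    by (rule arg_cong[where f = exp]) (simp add: algebra_simps)
  also have "exp (2 * of_int n * complex_of_real pi * \<i>) = 1"
    using exp_integer_2pi[of "of_int n"] by simp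
  finally show "theta_term3 \<tau> (x + complex_of_real pi / 3) y t = theta_term3 \<tau> x y t" by simp
qed

theorem theorem3p1:
  fixes \<tau> x y :: complex
  assumes "Im \<tau> > 0"
  shows "cubic_theta_C x y \<tau> ^ 3 - cubic_theta_C (- x) (- y) \<tau> ^ 3 =
         cubic_theta_C (x + complex_of_real pi / 3) y \<tau> ^ 3
           - cubic_theta_C (- x - complex_of_real pi / 3) (- y) \<tau> ^ 3"
proof -
  \<comment> \<open>Part 1 at each of (u, y) and (- u, - y) cancels part 2 at the other.\<close>
  have *: "cubic_theta_C u y \<tau> ^ 3 - cubic_theta_C (- u) (- y) \<tau> ^ 3
      = part 0 \<tau> u y - part 0 \<tau> (- u) (- y)" for u
    using part_1_eq_part_2[of \<tau> u y] part_1_eq_part_2[of \<tau> "- u" "- y"]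
    by (simp add: cubic_theta_C_cube[OF assms])
  show ?thesis
    \<comment> \<open>The second use of \<open>part_0_shift\<close> starts at - x - pi/3 and ends at
      - x.\<close>
    using *[of x] *[of "x + complex_of_real pi / 3"] part_0_shift[of \<tau> x y]
      part_0_shift[of \<tau> "- x - complex_of_real pi / 3" "- y"]
    by simp
qed

end
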